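(* For every integer $n$ and every $d=d(n)$ with $16\le d\le 2^{n/4}$, $\mathsf{OBDD^{\lfloor d/8\rfloor-1}}\subsetneq\mathsf{OBDD^{d}}$ and $\mathsf{NOBDD^{\lfloor d/8\rfloor-1}}\subsetneq\mathsf{NOBDD^{d}}$.
   Context: $\mathsf{OBDD^d}$ (resp. $\mathsf{NOBDD^d}$) denotes the set of Boolean functions $f:\{0,1\}^n\to\{0,1\}$ computable by a deterministic (resp. nondeterministic) OBDD of width $d$ (at most $d$ nodes per level), $n$ being the number of variables. A deterministic OBDD on $x_1,\dots,x_n$ with order $\pi$ (a permutation of $\{1,\dots,n\}$) is a leveled directed acyclic graph with levels $0,\dots,n$, a single source at level $0$, every node at level $j-1$ having exactly one outgoing edge labelled $0$ and one labelled $1$ to nodes at level $j$, and nodes at level $n$ marked accepting or rejecting; on input $\nu$ one follows from the source at step $j$ the edge labelled $\nu_{\pi(j)}$ and outputs $1$ iff an accepting node is reached. A nondeterministic OBDD allows any number of outgoing edges with each label and outputs $1$ iff some consistent path reaches an accepting node. Width is the maximum number of nodes in a level. *)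

theory Defs
  imports Complex_Main "HOL-Library.FuncSet" "HOL-Combinatorics.Permutations"
begin

definition bool_inputs :: "nat \<Rightarrow> (nat \<Rightarrow> bool) set" where
  "bool_inputs n = {1..n} \<rightarrow>\<^sub>E UNIV"

text \<open>
  Inputs and Boolean functions are extensional, so that two Boolean functions of
  \<open>n\<close> variables are equal as HOL functions iff they agree on all of \<open>bool_inputs n\<close>.
\<close>

definition bool_functions :: "nat \<Rightarrow> ((nat \<Rightarrow> bool) \<Rightarrow> bool) set" where
  "bool_functions n = bool_inputs n \<rightarrow>\<^sub>E UNIV"

text \<open>An edge \<open>(u, b, v)\<close> leads from \<open>u\<close> to \<open>v\<close> and is labelled \<open>b\<close>.\<close>

record 'v bdd =
  var_order :: "nat \<Rightarrow> nat"
  level :: "nat \<Rightarrow> 'v set"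
  source :: 'v
  edges :: "('v \<times> bool \<times> 'v) set"
  accepting :: "'v set"

definition nobdd :: "nat \<Rightarrow> 'v bdd \<Rightarrow> bool" where
  "nobdd n B \<longleftrightarrow>
     var_order B permutes {1..n} \<and>
     (\<forall>j\<in>{0..n}. finite (level B j)) \<and>
     (\<forall>i\<in>{0..n}. \<forall>j\<in>{0..n}. i \<noteq> j \<longrightarrow> level B i \<inter> level B j = {}) \<and>
     level B 0 = {source B} \<and>
     edges B \<subseteq> (\<Union>j\<in>{1..n}. level B (j - 1) \<times> UNIV \<times> level B j) \<and>
     accepting B \<subseteq> level B n"

definition obdd :: "nat \<Rightarrow> 'v bdd \<Rightarrow> bool" where
  "obdd n B \<longleftrightarrow>
     nobdd n B \<and>
     (\<forall>j\<in>{1..n}. \<forall>u\<in>level B (j - 1). \<forall>b. \<exists>!v. (u, b, v) \<in> edges B)"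

definition width :: "nat \<Rightarrow> 'v bdd \<Rightarrow> nat" where
  "width n B = Max ((\<lambda>j. card (level B j)) ` {0..n})"

definition consistent_path :: "nat \<Rightarrow> 'v bdd \<Rightarrow> (nat \<Rightarrow> bool) \<Rightarrow> (nat \<Rightarrow> 'v) \<Rightarrow> bool" where
  "consistent_path n B \<nu> p \<longleftrightarrow>
     p 0 = source B \<and>
     (\<forall>j\<in>{1..n}. (p (j - 1), \<nu> (var_order B j), p j) \<in> edges B)"

text \<open>
  For a deterministic diagram the consistent path is unique up to level \<open>n\<close>, namely the
  one obtained by following the edges selected by the input.
\<close>

definition bdd_output :: "nat \<Rightarrow> 'v bdd \<Rightarrow> (nat \<Rightarrow> bool) \<Rightarrow> bool" where
  "bdd_output n B \<nu> \<longleftrightarrow> (\<exists>p. consistent_path n B \<nu> p \<and> p n \<in> accepting B)"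

definition computes :: "nat \<Rightarrow> 'v bdd \<Rightarrow> ((nat \<Rightarrow> bool) \<Rightarrow> bool) \<Rightarrow> bool" where
  "computes n B f \<longleftrightarrow> (\<forall>\<nu>\<in>bool_inputs n. f \<nu> = bdd_output n B \<nu>)"

text \<open>Diagrams are finite, so taking natural numbers as nodes is no restriction.\<close>

definition OBDD :: "nat \<Rightarrow> nat \<Rightarrow> ((nat \<Rightarrow> bool) \<Rightarrow> bool) set" where
  "OBDD n d = {f \<in> bool_functions n.
     \<exists>B :: nat bdd. obdd n B \<and> width n B \<le> d \<and> computes n B f}"

definition NOBDD :: "nat \<Rightarrow> nat \<Rightarrow> ((nat \<Rightarrow> bool) \<Rightarrow> bool) set" where
  "NOBDD n d = {f \<in> bool_functions n.
     \<exists>B :: nat bdd. nobdd n B \<and> width n B \<le> d \<and> computes n B f}"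

end

theory Submission imports Defs "HOL-Library.Countable" begin

text \<open>
  The separating function reads \<open>2 * k\<close> pairs (marker, value), where
  \<open>2 ^ (k + 2) \<le> d < 2 ^ (k + 3)\<close>. It maintains a queue of at most \<open>k\<close> bits: the marker says
  whether the value is appended to the queue or has to match, and then removes, its first bit.
  An input is accepted iff no failure occurs and the queue is empty at the end. There are
  \<open>2 ^ (k + 1)\<close> queues (counting failure), and remembering the marker doubles this number.

  Conversely, in any nondeterministic diagram there is a level at which exactly \<open>k\<close> of the
  \<open>2 * k\<close> value variables have been read. For fixed markers, chosen so that the side that is
  ahead appends and the other side removes, the automaton tests whether the word read before that
  level equals the word read after it. The \<open>2 ^ k\<close> pairs of equal words form a fooling set, so
  the width is at least \<open>2 ^ k > d div 8 - 1\<close>.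
\<close>

section \<open>Diagrams from leveled automata\<close>

primrec run :: "(nat \<Rightarrow> 's \<Rightarrow> bool \<Rightarrow> 's) \<Rightarrow> 's \<Rightarrow> (nat \<Rightarrow> bool) \<Rightarrow> nat \<Rightarrow> 's" where
  "run \<delta> s \<nu> 0 = s"
| "run \<delta> s \<nu> (Suc j) = \<delta> j (run \<delta> s \<nu> j) (\<nu> (Suc j))"

lemma width_le_iff: "width n B \<le> d \<longleftrightarrow> (\<forall>j\<le>n. card (level B j) \<le> d)"
  unfolding width_def by (subst Max_le_iff) auto

text \<open>The automaton is unrolled in the identity order, one level per step. Diagrams in
  \<open>OBDD\<close> have natural numbers as nodes, so states must be countable to be
  encoded.\<close>

lemma automaton_in_OBDD:
  fixes Q :: "'s::countable set"
  assumes fin: "finite Q" and s0: "s0 \<in> Q"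
    and closed: "\<And>j s b. s \<in> Q \<Longrightarrow> \<delta> j s b \<in> Q"
  shows "(\<lambda>\<nu>\<in>bool_inputs n. run \<delta> s0 \<nu> n \<in> F) \<in> OBDD n (card Q)"
proof -
  \<comment> \<open>Level 0 may contain only the source.\<close>
  define L where "L = (\<lambda>j::nat. if j = 0 then {s0} else Q)"
  \<comment> \<open>Tagging a state with its level makes distinct levels disjoint.\<close>
  define e where "e = (\<lambda>(j::nat) (s::'s). to_nat (j, s))"
  have e_inj: "e i s = e j t \<longleftrightarrow> i = j \<and> s = t" for i j s t
    by (simp add: e_def)
  define B where "B = \<lparr>var_order = id, level = (\<lambda>j. e j ` L j), source = e 0 s0,
    edges = {(e j s, b, e (Suc j) (\<delta> j s b)) | j s b. j < n \<and> s \<in> L j},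
    accepting = e n ` (L n \<inter> F)\<rparr>"
  have L_sub: "L j \<subseteq> Q" and L_step: "s \<in> L j \<Longrightarrow> \<delta> j s b \<in> L (Suc j)" for j s b
    using s0 closed by (auto simp: L_def split: if_splits)
  have fin_L: "finite (L j)" for j
    using L_sub fin by (rule finite_subset)
  have edge_iff: "(e j s, b, v) \<in> edges B \<longleftrightarrow> j < n \<and> s \<in> L j \<and> v = e (Suc j) (\<delta> j s b)"
    for j s b v
    by (auto simp: B_def e_inj)
  have edge_levels: "edges B \<subseteq> (\<Union>j\<in>{1..n}. level B (j - 1) \<times> UNIV \<times> level B j)"
  proof
    fix x assume "x \<in> edges B"
    then obtain j s b where x: "x = (e j s, b, e (Suc j) (\<delta> j s b))" and "j < n" "s \<in> L j"
      by (auto simp: B_def)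
    then have "x \<in> level B (Suc j - 1) \<times> UNIV \<times> level B (Suc j)"
      using L_step by (auto simp: B_def)
    with \<open>j < n\<close> show "x \<in> (\<Union>j\<in>{1..n}. level B (j - 1) \<times> UNIV \<times> level B j)"
      by (intro UN_I[of "Suc j"]) auto
  qed
  have nobdd: "nobdd n B"
    unfolding nobdd_def using edge_levels fin_L
    by (auto simp: B_def e_inj permutes_id L_def)
  have obdd: "obdd n B"
    unfolding obdd_def
  proof (intro conjI ballI allI nobdd)
    fix j u b assume j: "j \<in> {1..n}" and u: "u \<in> level B (j - 1)"
    from u obtain s where "u = e (j - 1) s" "s \<in> L (j - 1)"
      by (auto simp: B_def)
    with j show "\<exists>!v. (u, b, v) \<in> edges B"
      by (auto simp: edge_iff)
  qed
  have width: "width n B \<le> card Q"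
    unfolding width_le_iff
  proof (intro allI impI)
    fix j
    have "card (level B j) \<le> card (L j)"
      by (simp add: B_def card_image_le fin_L)
    also have "\<dots> \<le> card Q"
      by (rule card_mono[OF fin L_sub])
    finally show "card (level B j) \<le> card Q" .
  qed
  have run_L: "run \<delta> s0 \<nu> j \<in> L j" for \<nu> j
    by (induction j) (auto simp: L_step, simp add: L_def)
  have "bdd_output n B \<nu> \<longleftrightarrow> run \<delta> s0 \<nu> n \<in> F" for \<nu>
  proof
    assume "bdd_output n B \<nu>"
    then obtain p where p: "consistent_path n B \<nu> p" "p n \<in> accepting B"
      by (auto simp: bdd_output_def)
    have "p j = e j (run \<delta> s0 \<nu> j)" if "j \<le> n" for j
      using that
    proof (induction j)
      case 0
      with p(1) show ?case by (simp add: consistent_path_def B_def)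
    next
      case (Suc j)
      then have "(p (Suc j - 1), \<nu> (var_order B (Suc j)), p (Suc j)) \<in> edges B"
        using p(1) unfolding consistent_path_def
        by (metis Suc_le_eq atLeastAtMost_iff le0 not_less_eq_eq One_nat_def)
      with Suc show ?case
        by (simp add: edge_iff) (simp add: B_def)
    qed
    with p(2) show "run \<delta> s0 \<nu> n \<in> F"
      by (auto simp: B_def e_inj)
  next
    assume acc: "run \<delta> s0 \<nu> n \<in> F"
    have "consistent_path n B \<nu> (\<lambda>j. e j (run \<delta> s0 \<nu> j))"
      unfolding consistent_path_def
    proof (intro conjI ballI)
      show "e 0 (run \<delta> s0 \<nu> 0) = source B" by (simp add: B_def)
      fix j assume "j \<in> {1..n}"
      then obtain i where "j = Suc i" "i < n" by (cases j) auto
      then show "(e (j - 1) (run \<delta> s0 \<nu> (j - 1)), \<nu> (var_order B j), e j (run \<delta> s0 \<nu> j)) \<in> edges B"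
        using run_L[of \<nu> i] by (simp add: edge_iff) (simp add: B_def)
    qed
    moreover have "e n (run \<delta> s0 \<nu> n) \<in> accepting B"
      using acc run_L by (auto simp: B_def)
    ultimately show "bdd_output n B \<nu>"
      unfolding bdd_output_def by (intro exI[of _ "\<lambda>j. e j (run \<delta> s0 \<nu> j)"]) auto
  qed
  then have "computes n B (\<lambda>\<nu>\<in>bool_inputs n. run \<delta> s0 \<nu> n \<in> F)"
    by (simp add: computes_def)
  moreover have "(\<lambda>\<nu>\<in>bool_inputs n. run \<delta> s0 \<nu> n \<in> F) \<in> bool_functions n"
    by (simp add: bool_functions_def)
  ultimately show ?thesis
    using obdd width unfolding OBDD_def by blast
qed

section \<open>Fooling sets\<close>

text \<open>Cut and paste: if accepting paths for \<open>x w\<close> and \<open>x w'\<close> met at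
  level \<open>j\<close>, the first up to \<open>j\<close> followed by the second would be an
  accepting path for the mixed input. So distinct words pass through distinct nodes of level
  \<open>j\<close>.\<close>

lemma fooling_set_le_width:
  fixes B :: "'v bdd"
  assumes B: "nobdd n B" and comp: "computes n B f" and j: "j \<le> n"
    and inputs: "\<And>w. w \<in> W \<Longrightarrow> x w \<in> bool_inputs n"
    and acc: "\<And>w. w \<in> W \<Longrightarrow> f (x w)"
    and fool: "\<And>w w'. \<lbrakk>w \<in> W; w' \<in> W; w \<noteq> w'\<rbrakk> \<Longrightarrow>
      \<not> f (\<lambda>i. if i \<in> var_order B ` {1..j} then x w i else x w' i)"
  shows "card W \<le> width n B"
proof -
  have "\<exists>p. consistent_path n B (x w) p \<and> p n \<in> accepting B" if "w \<in> W" for w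
    using comp inputs[OF that] acc[OF that] by (auto simp: computes_def bdd_output_def)
  then obtain p where p: "\<And>w. w \<in> W \<Longrightarrow> consistent_path n B (x w) (p w)"
    and p_acc: "\<And>w. w \<in> W \<Longrightarrow> p w n \<in> accepting B"
    by metis
  have perm: "var_order B permutes {1..n}"
    using B by (simp add: nobdd_def)
  have "inj_on (\<lambda>w. p w j) W"
  proof (rule inj_onI, rule ccontr)
    fix w w' assume w: "w \<in> W" "w' \<in> W" and eq: "p w j = p w' j" and ne: "w \<noteq> w'"
    define y where "y = (\<lambda>i. if i \<in> var_order B ` {1..j} then x w i else x w' i)"
    define q where "q = (\<lambda>i. if i \<le> j then p w i else p w' i)"
    have mem: "var_order B i \<in> var_order B ` {1..j} \<longleftrightarrow> i \<in> {1..j}" for i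
      by (rule inj_image_mem_iff[OF permutes_inj[OF perm]])
    have "y \<in> bool_inputs n"
      using inputs[OF w(1)] inputs[OF w(2)]
      by (auto simp: y_def bool_inputs_def PiE_iff extensional_def)
    moreover have "consistent_path n B y q"
      unfolding consistent_path_def
    proof (intro conjI ballI)
      show "q 0 = source B"
        using p[OF w(1)] by (simp add: q_def consistent_path_def)
      fix i assume i: "i \<in> {1..n}"
      have edge: "(p v (i - 1), x v (var_order B i), p v i) \<in> edges B" if "v \<in> W" for v
        using p[OF that] i by (simp add: consistent_path_def)
      show "(q (i - 1), y (var_order B i), q i) \<in> edges B"
      proof (cases "i \<le> j")
        case True
        then have "i - 1 \<le> j" by simp
        with True i show ?thesis using edge[OF w(1)] by (simp add: q_def y_def mem)
      next
        case False
        \<comment> \<open>At \<open>i - 1 = j\<close> the walk \<open>q\<close> still follows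
          \<open>p w\<close>; the two paths share this node.\<close>
        then have "q (i - 1) = p w' (i - 1)"
          using eq by (cases "i - 1 = j") (auto simp: q_def)
        moreover have "y (var_order B i) = x w' (var_order B i)"
          using False unfolding y_def mem by simp
        ultimately show ?thesis using False edge[OF w(2)] by (simp add: q_def)
      qed
    qed
    moreover have "q n \<in> accepting B"
      using p_acc[OF w(1)] p_acc[OF w(2)] eq j by (auto simp: q_def)
    ultimately have "f y"
      using comp by (auto simp: computes_def bdd_output_def)
    with fool[OF w ne] show False by (simp add: y_def)
  qed
  moreover have "(\<lambda>w. p w j) ` W \<subseteq> level B j"
  proof
    fix v assume "v \<in> (\<lambda>w. p w j) ` W"
    then obtain w where w: "w \<in> W" "v = p w j" by auto
    have lev: "p w i' \<in> level B i'" if "i' \<le> n" for i'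
      using that
    proof (induction i')
      case 0
      then show ?case using B p[OF w(1)] by (simp add: consistent_path_def nobdd_def)
    next
      case (Suc m)
      have "(p w m, x w (var_order B (Suc m)), p w (Suc m)) \<in> edges B"
        using p[OF w(1)] Suc.prems unfolding consistent_path_def
        by (metis One_nat_def Suc_le_mono atLeastAtMost_iff diff_Suc_1 le0)
      then obtain i where i: "i \<in> {1..n}" "p w m \<in> level B (i - 1)" "p w (Suc m) \<in> level B i"
        using B by (auto simp: nobdd_def)
      \<comment> \<open>The edge only lies between some two consecutive levels; disjointness of
        levels identifies them.\<close>
      have "i - 1 = m"
      proof (rule ccontr)
        assume "i - 1 \<noteq> m"
        moreover have "i - 1 \<in> {0..n}" "m \<in> {0..n}" using i Suc.prems by auto
        ultimately have "level B (i - 1) \<inter> level B m = {}"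
          using B unfolding nobdd_def by blast
        with i Suc show False by auto
      qed
      with i have "i = Suc m" by auto
      with i show ?case by simp
    qed
    with w j show "v \<in> level B j" by simp
  qed
  moreover have "finite (level B j)"
    using B j by (simp add: nobdd_def)
  ultimately have "card W \<le> card (level B j)"
    by (metis card_image card_mono)
  also have "\<dots> \<le> width n B"
    using j width_le_iff[of n B "width n B"] by simp
  finally show ?thesis .
qed

section \<open>The queue automaton\<close>

fun queue_step :: "nat \<Rightarrow> bool \<Rightarrow> bool \<Rightarrow> bool list option \<Rightarrow> bool list option" where
  "queue_step k m b None = None"
| "queue_step k True b (Some q) = (if length q < k then Some (q @ [b]) else None)"
| "queue_step k False b (Some []) = None"
| "queue_step k False b (Some (c # q)) = (if b = c then Some q else None)"

primrec queue_run :: "nat \<Rightarrow> (nat \<Rightarrow> bool) \<Rightarrow> nat \<Rightarrow> bool list option" where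
  "queue_run k \<nu> 0 = Some []"
| "queue_run k \<nu> (Suc i) = queue_step k (\<nu> (2 * i + 1)) (\<nu> (2 * i + 2)) (queue_run k \<nu> i)"

definition queue_fun :: "nat \<Rightarrow> nat \<Rightarrow> (nat \<Rightarrow> bool) \<Rightarrow> bool" where
  "queue_fun n k = (\<lambda>\<nu>\<in>bool_inputs n. queue_run k \<nu> (2 * k) = Some [])"

definition queues :: "nat \<Rightarrow> bool list option set" where
  "queues k = insert None (Some ` {q. length q \<le> k})"

lemma queue_step_closed: "q \<in> queues k \<Longrightarrow> queue_step k m b q \<in> queues k"
  by (cases "(k, m, b, q)" rule: queue_step.cases) (auto simp: queues_def)

lemma finite_card_queues: "finite (queues k)" "card (queues k) = 2 ^ (k + 1)"
proof -
  have fin: "finite {q :: bool list. length q \<le> k}"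
    using finite_lists_length_le[of "UNIV :: bool set" k] by simp
  then show "finite (queues k)"
    by (simp add: queues_def)
  have "card {q :: bool list. length q \<le> k} = (\<Sum>i\<le>k. 2 ^ i)"
    using card_lists_length_le[of "UNIV :: bool set" k] by simp
  also have "\<dots> = 2 ^ (k + 1) - 1"
    by (induction k) auto
  \<comment> \<open>The failure state \<open>None\<close> makes up for the
    \<open>- 1\<close>.\<close>
  finally show "card (queues k) = 2 ^ (k + 1)"
    using fin by (simp add: queues_def card_image card_insert_if image_iff)
qed

text \<open>The first component stores the marker between the two halves of a pair.\<close>

definition marker_step ::
  "nat \<Rightarrow> nat \<Rightarrow> bool \<times> bool list option \<Rightarrow> bool \<Rightarrow> bool \<times> bool list option" where
  "marker_step k j s b =
     (if 4 * k \<le> j then s else if even j then (b, snd s)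
      else (False, queue_step k (fst s) b (snd s)))"

text \<open>Steps count from 0, so an even step reads an odd variable, which is a marker. Since the
  stored marker is reset to \<open>False\<close> after each pair, the state between pairs depends on
  the queue alone.\<close>

lemma run_marker_step:
  assumes "i \<le> 2 * k"
  shows "run (marker_step k) (False, Some []) \<nu> (2 * i) = (False, queue_run k \<nu> i)"
  using assms by (induction i) (simp_all add: marker_step_def)

lemma run_marker_step_end:
  assumes "4 * k \<le> n"
  shows "run (marker_step k) (False, Some []) \<nu> n = (False, queue_run k \<nu> (2 * k))"
  using assms
proof (induction n rule: dec_induct)
  case base
  show ?case using run_marker_step[of "2 * k" k \<nu>] by (simp add: mult.assoc[symmetric])
next
  case (step n)
  then show ?case by (simp add: marker_step_def)
qed

lemma queue_fun_in_OBDD: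
  assumes "4 * k \<le> n"
  shows "queue_fun n k \<in> OBDD n (2 ^ (k + 2))"
proof -
  have "(\<lambda>\<nu>\<in>bool_inputs n. run (marker_step k) (False, Some []) \<nu> n \<in> {(False, Some [])})
    \<in> OBDD n (card ((UNIV :: bool set) \<times> queues k))"
    by (rule automaton_in_OBDD)
      (auto simp: finite_card_queues marker_step_def queue_step_closed, auto simp: queues_def)
  then show ?thesis
    using assms
    by (simp add: run_marker_step_end queue_fun_def card_cartesian_product finite_card_queues)
qed

section \<open>Comparing two interleaved words\<close>

text \<open>The intended queue content after \<open>u\<close> and \<open>v\<close> have been read
  from the two sides: the surplus of the longer word, or failure once they disagree on their common
  length. By symmetry the queue need not record which side is ahead.\<close>

definition lag :: "bool list \<Rightarrow> bool list \<Rightarrow> bool list option" where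
  "lag u v =
     (if length v \<le> length u
      then if take (length v) u = v then Some (drop (length v) u) else None
      else if take (length u) v = u then Some (drop (length u) v) else None)"

lemma lag_commute: "lag u v = lag v u"
  by (auto simp: lag_def)

lemma lag_eq_Nil: "length u = length v \<Longrightarrow> lag u v = Some [] \<longleftrightarrow> u = v"
  by (auto simp: lag_def)

text \<open>If \<open>u\<close> is not behind, \<open>b\<close> extends its surplus, which fits
  because it is at most \<open>length u < k\<close> long. If \<open>u\<close> is behind,
  \<open>b\<close> must match \<open>v ! length u\<close>, the head of the surplus of
  \<open>v\<close>. On a tie the queue is empty and either side appends.\<close>

lemma queue_step_lag:
  assumes "length u < k"
  shows "queue_step k (length v \<le> length u) b (lag u v) = lag (u @ [b]) v"
proof (cases "length v \<le> length u")
  case True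
  with assms show ?thesis by (auto simp: lag_def)
next
  case False
  then have less: "length u < length v" by simp
  have dr: "drop (length u) v = v ! length u # drop (Suc (length u)) v"
    using less by (rule Cons_nth_drop_Suc[symmetric])
  have tk: "take (Suc (length u)) v = take (length u) v @ [v ! length u]"
    using less by (rule take_Suc_conv_app_nth)
  have "lag (u @ [b]) v =
    (if take (length u) v = u \<and> v ! length u = b then Some (drop (Suc (length u)) v) else None)"
    using less tk by (subst lag_commute) (simp add: lag_def)
  moreover have "lag u v = (if take (length u) v = u then Some (drop (length u) v) else None)"
    using less by (simp add: lag_def)
  ultimately show ?thesis
    using False by (auto simp: dr)
qed

text \<open>For \<open>i\<close> satisfying \<open>P\<close>, this is the position, counted from 0,
  of \<open>i\<close> among all such indices, hence the index of the letter that pair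
  \<open>i\<close> takes from its word.\<close>

definition rank :: "(nat \<Rightarrow> bool) \<Rightarrow> nat \<Rightarrow> nat" where
  "rank P i = card {l. l < i \<and> P l}"

lemma rank_0: "rank P 0 = 0"
  by (simp add: rank_def)

lemma rank_Suc: "rank P (Suc i) = (if P i then Suc (rank P i) else rank P i)"
proof -
  have "{l. l < Suc i \<and> P l} = (if P i then insert i {l. l < i \<and> P l} else {l. l < i \<and> P l})"
    by (auto simp: less_Suc_eq)
  then show ?thesis by (simp add: rank_def)
qed

lemma rank_mono: "i \<le> j \<Longrightarrow> rank P i \<le> rank P j"
  unfolding rank_def by (rule card_mono) auto

lemma rank_compl: "rank P i + rank (\<lambda>l. \<not> P l) i = i"
  by (induction i) (simp_all add: rank_0 rank_Suc)

text \<open>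
  Pair \<open>i\<close>, counted from 0, consists of the marker variable \<open>2 * i + 1\<close> and the value variable
  \<open>2 * i + 2\<close>; its value is taken from \<open>u\<close> if \<open>P i\<close> and from \<open>v\<close> otherwise.
\<close>

definition two_word_input ::
  "nat \<Rightarrow> (nat \<Rightarrow> bool) \<Rightarrow> bool list \<Rightarrow> bool list \<Rightarrow> nat \<Rightarrow> bool" where
  "two_word_input n P u v = (\<lambda>j\<in>{1..n}. let i = (j - 1) div 2;
       r = rank P i; r' = rank (\<lambda>l. \<not> P l) i in
     if even j then if P i then u ! r else v ! r'
     else if P i then r' \<le> r else r \<le> r')"

text \<open>Each pair lengthens the prefix read of one of the two words by one letter. The balance
  condition bounds both prefixes by \<open>k\<close>, so no append overflows.\<close>

lemma queue_run_two_word_input: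
  assumes k: "4 * k \<le> n" and P: "rank P (2 * k) = k" and len: "length u = k" "length v = k"
    and i: "i \<le> 2 * k"
  shows "queue_run k (two_word_input n P u v) i =
    lag (take (rank P i) u) (take (rank (\<lambda>l. \<not> P l) i) v)"
  using i
proof (induction i)
  case 0
  show ?case by (simp add: rank_0 lag_def)
next
  case (Suc i)
  let ?P' = "\<lambda>l. \<not> P l"
  have P': "rank ?P' (2 * k) = k"
    using rank_compl[of P "2 * k"] P by simp
  have le: "rank P (Suc i) \<le> k" "rank ?P' (Suc i) \<le> k"
    using rank_mono[OF Suc.prems, of P] rank_mono[OF Suc.prems, of ?P'] P P' by simp_all
  have le0: "rank P i \<le> k" "rank ?P' i \<le> k"
    using le rank_mono[of i "Suc i" P] rank_mono[of i "Suc i" ?P'] by simp_all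
  have dom: "2 * i + 1 \<in> {1..n}" "2 * i + 2 \<in> {1..n}"
    using Suc.prems k by auto
  have IH: "queue_run k (two_word_input n P u v) i = lag (take (rank P i) u) (take (rank ?P' i) v)"
    using Suc by simp
  show ?case
  proof (cases "P i")
    case True
    then have less: "rank P i < k" using le by (simp add: rank_Suc)
    have "take (rank P (Suc i)) u = take (rank P i) u @ [u ! rank P i]"
      using True less len by (simp add: rank_Suc take_Suc_conv_app_nth)
    moreover have "rank ?P' (Suc i) = rank ?P' i"
      using True by (simp add: rank_Suc)
    moreover have "two_word_input n P u v (2 * i + 1) \<longleftrightarrow> rank ?P' i \<le> rank P i"
      "two_word_input n P u v (2 * i + 2) \<longleftrightarrow> u ! rank P i"
      using True dom by (simp_all add: two_word_input_def)
    ultimately show ?thesis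
      using queue_step_lag[of "take (rank P i) u" k "take (rank ?P' i) v" "u ! rank P i"]
        less le0 len IH by simp
  next
    case False
    then have less: "rank ?P' i < k" using le by (simp add: rank_Suc)
    have "take (rank ?P' (Suc i)) v = take (rank ?P' i) v @ [v ! rank ?P' i]"
      using False less len by (simp add: rank_Suc take_Suc_conv_app_nth)
    moreover have "rank P (Suc i) = rank P i"
      using False by (simp add: rank_Suc)
    moreover have "two_word_input n P u v (2 * i + 1) \<longleftrightarrow> rank P i \<le> rank ?P' i"
      "two_word_input n P u v (2 * i + 2) \<longleftrightarrow> v ! rank ?P' i"
      using False dom by (simp_all add: two_word_input_def)
    \<comment> \<open>The words exchange roles, which the symmetry of \<open>lag\<close>
      permits.\<close>
    ultimately show ?thesis
      using queue_step_lag[of "take (rank ?P' i) v" k "take (rank P i) u" "v ! rank ?P' i"]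
        less le0 len IH by (simp add: lag_commute)
  qed
qed

lemma two_word_input_in_bool_inputs: "two_word_input n P u v \<in> bool_inputs n"
  by (simp add: two_word_input_def bool_inputs_def)

lemma queue_fun_two_word_input:
  assumes "4 * k \<le> n" and "rank P (2 * k) = k" and "length u = k" "length v = k"
  shows "queue_fun n k (two_word_input n P u v) \<longleftrightarrow> u = v"
  using queue_run_two_word_input[OF assms order_refl] rank_compl[of P "2 * k"] assms
  by (simp add: queue_fun_def two_word_input_in_bool_inputs lag_eq_Nil)

section \<open>The lower bound\<close>

text \<open>The number of value variables among the first \<open>j\<close> variables read goes from
  0 to \<open>2 * k\<close> in steps of at most one, so it takes the value \<open>k\<close> by the
  discrete intermediate value theorem.\<close>

lemma balanced_level:
  assumes perm: "\<pi> permutes {1..n}" and k: "4 * k \<le> n"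
  shows "\<exists>j\<le>n. rank (\<lambda>i. 2 * i + 2 \<in> \<pi> ` {1..j}) (2 * k) = k"
proof -
  define c where "c = (\<lambda>j. rank (\<lambda>i. 2 * i + 2 \<in> \<pi> ` {1..j}) (2 * k))"
  have step: "c j \<le> c (Suc j) \<and> c (Suc j) \<le> c j + 1" for j
  proof
    let ?X = "\<lambda>j. {l. l < 2 * k \<and> 2 * l + 2 \<in> \<pi> ` {1..j}}"
    have img: "\<pi> ` {1..Suc j} = insert (\<pi> (Suc j)) (\<pi> ` {1..j})"
      by (simp add: atLeastAtMostSuc_conv)
    show "c j \<le> c (Suc j)"
      unfolding c_def rank_def by (rule card_mono) (auto simp: img)
    \<comment> \<open>Only the pair whose value variable is \<open>\<pi> (Suc j)\<close> can be new;
      for an odd variable the inserted index merely enlarges the upper bound.\<close>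
    have "?X (Suc j) \<subseteq> insert (\<pi> (Suc j) div 2 - 1) (?X j)"
      unfolding img by auto
    then have "card (?X (Suc j)) \<le> card (insert (\<pi> (Suc j) div 2 - 1) (?X j))"
      by (intro card_mono) auto
    also have "\<dots> \<le> card (?X j) + 1"
      by (simp add: card_insert_if)
    finally show "c (Suc j) \<le> c j + 1"
      unfolding c_def rank_def .
  qed
  have "c n = card {..<2 * k}"
    unfolding c_def rank_def permutes_image[OF perm]
    using k by (intro arg_cong[where f = card]) auto
  then have cn: "c n = 2 * k" by simp
  have c0: "c 0 = 0" by (simp add: c_def rank_def)
  have "\<exists>j\<le>n. int (c j) = int k"
  proof (rule nat0_intermed_int_val)
    show "\<forall>i<n. \<bar>int (c (i + 1)) - int (c i)\<bar> \<le> 1"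
    proof (intro allI impI)
      fix i show "\<bar>int (c (i + 1)) - int (c i)\<bar> \<le> 1"
        using step[of i] by simp
    qed
  qed (use c0 cn in auto)
  then show ?thesis by (simp add: c_def)
qed

lemma nobdd_queue_fun_width:
  assumes B: "nobdd n B" and comp: "computes n B (queue_fun n k)"
    and k: "4 * k \<le> n"
  shows "2 ^ k \<le> width n B"
proof -
  have "var_order B permutes {1..n}"
    using B by (simp add: nobdd_def)
  from balanced_level[OF this k] obtain j where j: "j \<le> n"
    and bal: "rank (\<lambda>i. 2 * i + 2 \<in> var_order B ` {1..j}) (2 * k) = k"
    by blast
  define P where "P = (\<lambda>i. 2 * i + 2 \<in> var_order B ` {1..j})"
  have P: "rank P (2 * k) = k" using bal by (simp add: P_def)
  define W where "W = {w :: bool list. length w = k}"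
  \<comment> \<open>The markers depend on \<open>P\<close> only and thus agree in both inputs, while
    a value variable is read by level \<open>j\<close> exactly if its pair satisfies
    \<open>P\<close>. Mixing therefore takes the first word from \<open>w\<close> and the second
    from \<open>w'\<close>.\<close>
  have mix: "(\<lambda>i. if i \<in> var_order B ` {1..j} then two_word_input n P w w i
      else two_word_input n P w' w' i) = two_word_input n P w w'" for w w'
  proof
    fix i
    have "P ((i - 1) div 2) \<longleftrightarrow> i \<in> var_order B ` {1..j}" if "even i" "i \<in> {1..n}"
    proof -
      have "2 * ((i - 1) div 2) + 2 = i"
        using that by (auto elim!: evenE)
      then show ?thesis by (simp add: P_def)
    qed
    then show "(if i \<in> var_order B ` {1..j} then two_word_input n P w w i
      else two_word_input n P w' w' i) = two_word_input n P w w' i"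
      by (auto simp: two_word_input_def Let_def)
  qed
  have "card W \<le> width n B"
  proof (rule fooling_set_le_width[OF B comp j, where x = "\<lambda>w. two_word_input n P w w"])
    show "\<not> queue_fun n k (\<lambda>i. if i \<in> var_order B ` {1..j} then two_word_input n P w w i
      else two_word_input n P w' w' i)" if "w \<in> W" "w' \<in> W" "w \<noteq> w'" for w w'
      using that unfolding mix by (simp add: queue_fun_two_word_input[OF k P] W_def)
  qed (auto simp: queue_fun_two_word_input[OF k P] W_def two_word_input_in_bool_inputs)
  moreover have "card W = 2 ^ k"
    using card_lists_length_eq[of "UNIV :: bool set" k] by (simp add: W_def)
  ultimately show ?thesis by simp
qed

section \<open>Monotonicity in the width and the strict inclusions\<close>

lemma OBDD_subset_NOBDD: "OBDD n d \<subseteq> NOBDD n d"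
  by (auto simp: OBDD_def NOBDD_def obdd_def)

lemma OBDD_mono: "a \<le> b \<Longrightarrow> OBDD n a \<subseteq> OBDD n b"
  unfolding OBDD_def using order_trans by blast

lemma NOBDD_mono: "a \<le> b \<Longrightarrow> NOBDD n a \<subseteq> NOBDD n b"
  unfolding NOBDD_def using order_trans by blast

theorem theorem9:
  fixes n d :: nat
  assumes "16 \<le> d" and "real d \<le> 2 powr (real n / 4)"
  shows "OBDD n (d div 8 - 1) \<subset> OBDD n d \<and> NOBDD n (d div 8 - 1) \<subset> NOBDD n d"
proof -
  obtain l where l: "2 ^ l \<le> d" "d < 2 ^ (l + 1)"
    using ex_power_ivl1[of 2 d] assms(1) by auto
  have "(2::nat) ^ 4 < 2 ^ (l + 1)"
    using l(2) assms(1) by simp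
  then have "3 < l"
    by (subst (asm) power_strict_increasing_iff) auto
  then obtain k where k: "l = k + 2"
    using that[of "l - 2"] by simp
  have "2 powr real l \<le> real d"
    using of_nat_mono[OF l(1), where 'a = real] by (simp add: powr_realpow)
  with assms(2) have "2 powr real l \<le> 2 powr (real n / 4)"
    by linarith
  \<comment> \<open>Comparing exponents gives \<open>l \<le> n / 4\<close>, and
    \<open>k < l\<close>.\<close>
  then have kn: "4 * k \<le> n"
    using k by simp
  have "queue_fun n k \<in> OBDD n d"
    using queue_fun_in_OBDD[OF kn] OBDD_mono l(1) k by blast
  \<comment> \<open>One function separates both pairs of classes: it has a deterministic diagram of
    width \<open>d\<close>, and not even a nondeterministic one of width
    \<open>d div 8 - 1\<close>.\<close>
  moreover have "queue_fun n k \<notin> NOBDD n (d div 8 - 1)"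
  proof
    assume "queue_fun n k \<in> NOBDD n (d div 8 - 1)"
    then obtain B :: "nat bdd" where "nobdd n B" "width n B \<le> d div 8 - 1"
      "computes n B (queue_fun n k)"
      by (auto simp: NOBDD_def)
    with nobdd_queue_fun_width[OF _ _ kn] have "2 ^ k \<le> d div 8 - 1"
      by (meson order_trans)
    moreover have "d < 8 * 2 ^ k"
      using l(2) k by simp
    ultimately show False
      using assms(1) by linarith
  qed
  moreover have "d div 8 - 1 \<le> d" by linarith
  ultimately show ?thesis
    using OBDD_mono NOBDD_mono OBDD_subset_NOBDD by blast
qed

end
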